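(* Let $F$ be a field and let $n$ and $r$ be integers such that $1\leq r<2n$. Let $N(n,r)$ denote the cardinality of the double coset space $S\backslash GL_{2n}(F)/P_{r,2n-r}$. Put $\alpha=\max\{0,r-n\}$, $\gamma=\min\{r,n\}$ and $\beta=\lfloor \frac{r}{2} \rfloor$. Then $$N(n,r)=\frac{(\beta-\alpha+1)(\beta-\alpha+2)+(\gamma-\beta)(\gamma-\beta+1)}{2}.$$
   Context: $\mathcal{M}_{m,n}(F)$ denotes the space of $m\times n$ matrices over $F$ and $\mathcal{M}_n(F)=\mathcal{M}_{n,n}(F)$. The maximal standard parabolic subgroup of $GL_{2n}(F)$ associated to $(r,2n-r)$ is $$P_{r,2n-r} = \left\{ \begin{pmatrix} g_1 & x\\ 0 & g_2 \end{pmatrix} : g_1 \in GL_r(F),\ g_2 \in GL_{2n-r}(F),\ x \in \mathcal{M}_{r,2n-r}(F) \right\}.$$ The Shalika subgroup of $GL_{2n}(F)$ is $$S = \left\{ \begin{pmatrix} g & x\\ 0 & g \end{pmatrix} : g \in GL_n(F),\ x \in \mathcal{M}_n(F)\right\}.$$ $\lfloor \frac{r}{2}\rfloor$ is the largest integer not exceeding $r/2$. *)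

theory Defs
  imports
    "HOL-Algebra.Coset"
    "Jordan_Normal_Form.Determinant"
begin

definition GL :: "nat \<Rightarrow> 'a::field mat monoid" where
  "GL m = units_of (ring_mat TYPE('a) m ())"

lemma group_GL: "group (GL m :: 'a::field mat monoid)"
proof -
  interpret R: semiring "ring_mat TYPE('a) m ()" by (rule semiring_mat)
  show ?thesis unfolding GL_def by (rule R.units_group)
qed

lemma mult_GL: "A \<otimes>\<^bsub>GL m\<^esub> B = A * (B :: 'a::field mat)"
  by (simp add: GL_def units_of_mult ring_mat_def)

lemma one_GL: "\<one>\<^bsub>GL m\<^esub> = (1\<^sub>m m :: 'a::field mat)"
  by (simp add: GL_def units_of_one ring_mat_def)

lemma carrier_GL:
  "carrier (GL m) = {A :: 'a::field mat. A \<in> carrier_mat m m \<and> invertible_mat A}"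
proof (intro equalityI subsetI)
  fix A :: "'a mat" assume "A \<in> carrier (GL m)"
  then show "A \<in> {A. A \<in> carrier_mat m m \<and> invertible_mat A}"
    unfolding GL_def units_of_carrier Units_def ring_mat_def
    by (auto simp: invertible_mat_def inverts_mat_def)
next
  fix A :: "'a mat" assume "A \<in> {A. A \<in> carrier_mat m m \<and> invertible_mat A}"
  then obtain B where A: "A \<in> carrier_mat m m" and AB: "A * B = 1\<^sub>m m"
    and BA: "B * A = 1\<^sub>m (dim_row B)"
    by (auto simp: invertible_mat_def inverts_mat_def)
  from arg_cong[OF AB, of dim_col] arg_cong[OF BA, of dim_col] A
  have "B \<in> carrier_mat m m" by auto
  with A AB BA show "A \<in> carrier (GL m)"
    unfolding GL_def units_of_carrier Units_def ring_mat_def by auto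
qed

definition parabolic :: "nat \<Rightarrow> nat \<Rightarrow> 'a::field mat set" where
  "parabolic r s =
     {four_block_mat g\<^sub>1 x (0\<^sub>m s r) g\<^sub>2 | g\<^sub>1 g\<^sub>2 x.
        g\<^sub>1 \<in> carrier (GL r) \<and> g\<^sub>2 \<in> carrier (GL s) \<and> x \<in> carrier_mat r s}"

definition shalika :: "nat \<Rightarrow> 'a::field mat set" where
  "shalika n =
     {four_block_mat g x (0\<^sub>m n n) g | g x. g \<in> carrier (GL n) \<and> x \<in> carrier_mat n n}"

text \<open>The double coset space \<open>H \ G / K\<close>, as the set of the subsets \<open>H g K\<close> of \<open>G\<close>.\<close>

definition double_cosets :: "('a, 'b) monoid_scheme \<Rightarrow> 'a set \<Rightarrow> 'a set \<Rightarrow> 'a set set" where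
  "double_cosets G H K = {(H #>\<^bsub>G\<^esub> g) <#>\<^bsub>G\<^esub> K | g. g \<in> carrier G}"

end

theory Submission
  imports Defs "HOL-Library.Function_Algebras"
begin

text \<open>
  The parabolic subgroup is the stabilizer of \<open>F\<^sup>r\<close> in \<open>F\<^sup>2\<^sup>n\<close>, so the double cosets are the orbits
  of the Shalika subgroup on \<open>r\<close>-dimensional subspaces \<open>W\<close>. The Shalika subgroup is the centralizer of the
  nilpotent map \<open>N (u, v) = (v, 0)\<close>. Put \<open>A = W \<inter> F\<^sup>n\<close> and \<open>B = N W\<close>, two subspaces of \<open>F\<^sup>n\<close>. A basis of
  \<open>F\<^sup>n\<close> containing bases of \<open>A\<close> and \<open>B\<close>, together with lifts of it along \<open>N\<close> (chosen in \<open>W\<close> for the basis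
  of \<open>B\<close>), gives an element of the Shalika subgroup that carries a coordinate subspace onto \<open>W\<close>. Hence the
  orbit is determined by \<open>a = dim A\<close> and \<open>c = dim (A \<inter> B)\<close>, with \<open>dim B = r - a\<close>, and it remains to count
  the pairs with \<open>c \<le> a \<le> r - c\<close> and \<open>r - n \<le> c\<close>.
\<close>

section \<open>Bases adapted to two subspaces, and matching of index sets\<close>

text \<open>A basis \<open>C\<close> of the intersection grows to a basis \<open>A0\<close> of
  \<open>A\<close>, then by vectors of \<open>B\<close> to a basis \<open>E\<close> of the sum, then
  to \<open>D\<close>. The set \<open>C \<union> (E - A0)\<close> spans \<open>B\<close>: for
  \<open>b = x + y\<close> with \<open>x\<close> in \<open>A\<close> and \<open>y\<close> in the
  span of \<open>E - A0\<close>, hence in \<open>B\<close>, the difference \<open>x = b - y\<close>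
  lies in both subspaces and so in the span of \<open>C\<close>.\<close>

lemma (in vector_space) adapted_basis:
  assumes A: "subspace A" "A \<subseteq> V" and B: "subspace B" "B \<subseteq> V"
  obtains D A0 B0 where "independent D" "D \<subseteq> V" "V \<subseteq> span D"
    "A0 \<subseteq> D" "span A0 = A" "B0 \<subseteq> D" "span B0 = B"
proof -
  obtain C where C: "C \<subseteq> A \<inter> B" "independent C" "A \<inter> B \<subseteq> span C"
    using maximal_independent_subset[of "A \<inter> B"] by blast
  obtain A0 where A0: "C \<subseteq> A0" "A0 \<subseteq> A" "independent A0" "A \<subseteq> span A0"
    using maximal_independent_subset_extend[of C A] C by blast
  have spA: "span A0 = A"
    using A0 A by (intro span_subspace)
  obtain E where E: "A0 \<subseteq> E" "E \<subseteq> A0 \<union> B" "independent E" "A0 \<union> B \<subseteq> span E"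
    using maximal_independent_subset_extend[of A0 "A0 \<union> B"] A0 by blast
  obtain D where D: "E \<subseteq> D" "D \<subseteq> V" "independent D" "V \<subseteq> span D"
  proof (rule maximal_independent_subset_extend[of E V])
    show "E \<subseteq> V" using E(2) A0(2) A(2) B(2) by auto
  qed (use E(3) in auto)
  have sub: "C \<union> (E - A0) \<subseteq> B"
    using C E by blast
  have "B \<subseteq> span (C \<union> (E - A0))"
  proof
    fix b assume b: "b \<in> B"
    have "A0 \<union> (E - A0) = E" using E(1) by blast
    then have "b \<in> span (A0 \<union> (E - A0))" using E(4) b by auto
    then obtain x y where xy: "b = x + y" "x \<in> span A0" "y \<in> span (E - A0)"
      unfolding span_Un by blast
    have yB: "y \<in> B"
      using xy(3) span_minimal[OF _ B(1), of "E - A0"] sub by blast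
    have "x = b - y" using xy by simp
    then have "x \<in> A \<inter> B"
      using subspace_diff[OF B(1) b yB] xy spA by simp
    then have "x \<in> span C" using C by blast
    then show "b \<in> span (C \<union> (E - A0))"
      unfolding span_Un using xy by blast
  qed
  then have spB: "span (C \<union> (E - A0)) = B"
    using sub B by (intro span_subspace)
  show thesis
  proof (rule that[OF D(3,2,4) _ spA _ spB])
    show "A0 \<subseteq> D" using D E by (meson order_trans)
    show "C \<union> (E - A0) \<subseteq> D" using D E A0 by auto
  qed
qed

text \<open>The image of a basis is a basis of the same cardinality. No finite-dimensional ambient
  space is assumed, because the lemma is applied in the space of all functions on
  \<open>nat\<close>.\<close>

lemma (in vector_space) dim_linear_image:
  assumes "Vector_Spaces.linear scale scale f" "inj f"
  shows "dim (f ` W) = dim W"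
proof -
  interpret f: Vector_Spaces.linear scale scale f by fact
  obtain B where B: "B \<subseteq> W" "independent B" "W \<subseteq> span B" "card B = dim W"
    by (rule basis_exists)
  have "f ` W \<subseteq> span (f ` B)"
    using B(3) f.spans_image by blast
  moreover have "independent (f ` B)"
    using B(2) assms(2) f.independent_injective_image inj_on_subset by blast
  moreover have "card (f ` B) = dim W"
    using B(4) assms(2) by (metis card_image inj_on_subset subset_UNIV)
  ultimately show ?thesis
    using B(1) by (intro dim_unique[of "f ` B"]) auto
qed

text \<open>The two subsets cut each set into four cells, and the given cardinalities determine the
  size of every cell. Bijections between corresponding cells are glued together.\<close>

lemma bij_betw_matching_subsets:
  assumes X: "finite X" "A \<subseteq> X" "B \<subseteq> X"
    and X': "finite X'" "A' \<subseteq> X'" "B' \<subseteq> X'"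
    and c: "card X = card X'" "card A = card A'" "card B = card B'"
      "card (A \<inter> B) = card (A' \<inter> B')"
  obtains f where "bij_betw f X X'" "f ` A = A'" "f ` B = B'"
proof -
  note fin = finite_subset[OF X(2,1)] finite_subset[OF X(3,1)]
    finite_subset[OF X'(2,1)] finite_subset[OF X'(3,1)]
  have un: "card (A \<union> B) = card (A' \<union> B')"
    using card_Un_Int[of A B] card_Un_Int[of A' B'] fin c by simp
  have 1: "card (A - B) = card (A' - B')" "card (B - A) = card (B' - A')"
    using fin c by (simp_all add: card_Diff_subset_Int Int_commute)
  have 2: "card (X - (A \<union> B)) = card (X' - (A' \<union> B'))"
    using fin X X' c un by (simp add: card_Diff_subset)
  obtain f1 where f1: "bij_betw f1 (A \<inter> B) (A' \<inter> B')"
    using finite_same_card_bij[OF _ _ c(4)] fin by blast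
  obtain f2 where f2: "bij_betw f2 (A - B) (A' - B')"
    using finite_same_card_bij[OF _ _ 1(1)] fin by blast
  obtain f3 where f3: "bij_betw f3 (B - A) (B' - A')"
    using finite_same_card_bij[OF _ _ 1(2)] fin by blast
  obtain f4 where f4: "bij_betw f4 (X - (A \<union> B)) (X' - (A' \<union> B'))"
    using finite_same_card_bij[OF _ _ 2] X X' by blast
  define f where "f x = (if x \<in> A then if x \<in> B then f1 x else f2 x
    else if x \<in> B then f3 x else f4 x)" for x
  have g1: "bij_betw f (A \<inter> B) (A' \<inter> B')"
    using bij_betw_cong[of "A \<inter> B" f f1] f1 by (simp add: f_def)
  have g2: "bij_betw f (A - B) (A' - B')"
    using bij_betw_cong[of "A - B" f f2] f2 by (simp add: f_def)
  have g3: "bij_betw f (B - A) (B' - A')"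
    using bij_betw_cong[of "B - A" f f3] f3 by (simp add: f_def)
  have g4: "bij_betw f (X - (A \<union> B)) (X' - (A' \<union> B'))"
    using bij_betw_cong[of "X - (A \<union> B)" f f4] f4 by (simp add: f_def)
  have bA: "bij_betw f ((A \<inter> B) \<union> (A - B)) ((A' \<inter> B') \<union> (A' - B'))"
    by (rule bij_betw_combine[OF g1 g2]) auto
  have bB: "bij_betw f ((A \<inter> B) \<union> (B - A)) ((A' \<inter> B') \<union> (B' - A'))"
    by (rule bij_betw_combine[OF g1 g3]) auto
  have "bij_betw f ((((A \<inter> B) \<union> (A - B)) \<union> (B - A)) \<union> (X - (A \<union> B)))
     ((((A' \<inter> B') \<union> (A' - B')) \<union> (B' - A')) \<union> (X' - (A' \<union> B')))"
    by (rule bij_betw_combine[OF bij_betw_combine[OF bA g3] g4]) auto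
  moreover have "(((A \<inter> B) \<union> (A - B)) \<union> (B - A)) \<union> (X - (A \<union> B)) = X"
     "(((A' \<inter> B') \<union> (A' - B')) \<union> (B' - A')) \<union> (X' - (A' \<union> B')) = X'"
     "(A \<inter> B) \<union> (A - B) = A" "(A' \<inter> B') \<union> (A' - B') = A'"
     "(A \<inter> B) \<union> (B - A) = B" "(A' \<inter> B') \<union> (B' - A') = B'"
    using X X' by auto
  ultimately show thesis
    using bA bB by (intro that[of f]) (auto simp: bij_betw_def)
qed

section \<open>Coordinate subspaces of a function space\<close>

text \<open>Vectors of all lengths share the type of functions on \<open>nat\<close>: the space of
  vectors of length \<open>m\<close> is \<open>coord {..<m}\<close>, and the first factor of the
  doubled space is included in it literally, as \<open>coord {..<n}\<close>.\<close>

definition fscale :: "'a::field \<Rightarrow> (nat \<Rightarrow> 'a) \<Rightarrow> nat \<Rightarrow> 'a" where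
  "fscale c f = (\<lambda>i. c * f i)"

interpretation fn: vector_space "fscale :: 'a::field \<Rightarrow> _"
  by unfold_locales (auto simp: fscale_def fun_eq_iff algebra_simps)

lemma fscale_apply [simp]: "fscale c f i = c * f i"
  by (simp add: fscale_def)

lemma sum_apply: "(\<Sum>x\<in>X. F x) i = (\<Sum>x\<in>X. F x i)"
  for F :: "'b \<Rightarrow> nat \<Rightarrow> 'a::comm_monoid_add"
  by (induction X rule: infinite_finite_induct) auto

definition ev :: "nat \<Rightarrow> nat \<Rightarrow> 'a::field" where
  "ev j = (\<lambda>i. if i = j then 1 else 0)"

definition coord :: "nat set \<Rightarrow> (nat \<Rightarrow> 'a::field) set" where
  "coord J = {f. \<forall>i. i \<notin> J \<longrightarrow> f i = 0}"

lemma subspace_coord: "fn.subspace (coord J)"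
  by (auto simp: coord_def fn.subspace_def)

lemma coord_Int: "coord I \<inter> coord J = coord (I \<inter> J)"
  by (auto simp: coord_def)

lemma coord_mono: "I \<subseteq> J \<Longrightarrow> coord I \<subseteq> coord J"
  by (auto simp: coord_def)

lemma inj_ev: "inj ev"
  by (rule injI) (metis ev_def zero_neq_one)

lemma ev_in_coord: "j \<in> J \<Longrightarrow> ev j \<in> coord J"
  by (auto simp: coord_def ev_def)

lemma coord_eq_sum:
  assumes "finite J" "f \<in> coord J"
  shows "f = (\<Sum>j\<in>J. fscale (f j) (ev j))"
proof
  fix i
  have "(\<Sum>j\<in>J. f j * ev j i) = (\<Sum>j\<in>J. if i = j then f i else 0)"
    by (intro sum.cong) (auto simp: ev_def)
  also have "\<dots> = f i"
    using assms by (auto simp: coord_def)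
  finally show "f i = (\<Sum>j\<in>J. fscale (f j) (ev j)) i"
    by (simp add: sum_apply)
qed

lemma span_ev:
  assumes "finite J"
  shows "fn.span (ev ` J) = (coord J :: (nat \<Rightarrow> 'a::field) set)"
proof (rule fn.span_subspace[OF _ _ subspace_coord])
  show "(coord J :: (nat \<Rightarrow> 'a) set) \<subseteq> fn.span (ev ` J)"
  proof
    fix f :: "nat \<Rightarrow> 'a" assume "f \<in> coord J"
    then have "f = (\<Sum>j\<in>J. fscale (f j) (ev j))"
      using assms coord_eq_sum by blast
    also have "\<dots> \<in> fn.span (ev ` J)"
      by (intro fn.span_sum fn.span_scale fn.span_base) auto
    finally show "f \<in> fn.span (ev ` J)" .
  qed
qed (auto intro: ev_in_coord)

lemma independent_ev: "fn.independent (ev ` J :: (nat \<Rightarrow> 'a::field) set)"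
proof (rule fn.independent_mono[of "range ev"])
  show "fn.independent (range ev :: (nat \<Rightarrow> 'a) set)"
    unfolding fn.independent_explicit_module
  proof (intro allI impI)
    fix t and u :: "(nat \<Rightarrow> 'a) \<Rightarrow> 'a" and w :: "nat \<Rightarrow> 'a"
    assume t: "finite t" "t \<subseteq> range ev" "(\<Sum>v\<in>t. fscale (u v) v) = 0" and w: "w \<in> t"
    obtain j where j: "w = ev j" using t(2) w by auto
    \<comment> \<open>Evaluation at \<open>j\<close> isolates the coefficient of
      \<open>ev j\<close>.\<close>
    have "0 = (\<Sum>v\<in>t. u v * v j)"
      using arg_cong[OF t(3), of "\<lambda>f. f j"] by (simp add: sum_apply)
    also have "\<dots> = (\<Sum>v\<in>t. if v = ev j then u v else 0)"
    proof (intro sum.cong refl)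
      fix v assume "v \<in> t"
      then obtain k where "v = ev k" using t(2) by auto
      then show "u v * v j = (if v = ev j then u v else 0)"
        using inj_eq[OF inj_ev, of k j] by (auto simp: ev_def)
    qed
    also have "\<dots> = u (ev j)"
      using t w j by simp
    finally show "u w = 0" using j by simp
  qed
qed auto

lemma dim_coord: "finite J \<Longrightarrow> fn.dim (coord J :: (nat \<Rightarrow> 'a::field) set) = card J"
  by (rule fn.dim_unique[of "ev ` J"])
    (auto simp: span_ev independent_ev card_image[OF inj_on_subset[OF inj_ev]] intro: ev_in_coord)

section \<open>The action of matrices on functions\<close>

text \<open>Acting as the identity on the coordinates beyond the size of the matrix makes \<open>mact\<close> an action
  of \<open>GL\<close> by bijections of the whole, infinite-dimensional, space of functions.\<close>

definition mact :: "'a::field mat \<Rightarrow> (nat \<Rightarrow> 'a) \<Rightarrow> nat \<Rightarrow> 'a" where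
  "mact A f = (\<lambda>i. if i < dim_row A then \<Sum>j<dim_row A. A $$ (i, j) * f j else f i)"

lemma linear_mact: "Vector_Spaces.linear fscale fscale (mact A)"
  by unfold_locales
    (auto simp: mact_def fun_eq_iff algebra_simps sum.distrib sum_distrib_left)

lemma mact_mult:
  assumes "A \<in> carrier_mat m m" "B \<in> carrier_mat m m"
  shows "mact (A * B) f = mact A (mact B f)"
proof
  fix i
  have "(\<Sum>j<m. (A * B) $$ (i, j) * f j) = (\<Sum>j<m. A $$ (i, j) * (\<Sum>k<m. B $$ (j, k) * f k))"
    if "i < m"
  proof -
    have "(\<Sum>j<m. (A * B) $$ (i, j) * f j) = (\<Sum>j<m. \<Sum>k<m. A $$ (i, k) * B $$ (k, j) * f j)"
      using assms that
      by (intro sum.cong) (auto simp: scalar_prod_def sum_distrib_right lessThan_atLeast0)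
    also have "\<dots> = (\<Sum>k<m. \<Sum>j<m. A $$ (i, k) * B $$ (k, j) * f j)"
      by (rule sum.swap)
    finally show ?thesis
      by (simp add: sum_distrib_left mult.assoc)
  qed
  then show "mact (A * B) f i = mact A (mact B f) i"
    using assms by (auto simp: mact_def intro!: sum.cong)
qed

lemma mact_one: "mact (1\<^sub>m m) f = f"
proof
  fix i
  have "i < m \<Longrightarrow> (\<Sum>j<m. 1\<^sub>m m $$ (i, j) * f j) = (\<Sum>j<m. if i = j then f i else 0)"
    by (intro sum.cong) auto
  then show "mact (1\<^sub>m m) f i = f i"
    by (simp add: mact_def)
qed

lemma mact_ev:
  assumes "A \<in> carrier_mat m m" "j < m"
  shows "mact A (ev j) i = (if i < m then A $$ (i, j) else 0)"
proof -
  have "(\<Sum>k<m. A $$ (i, k) * ev j k) = (\<Sum>k<m. if k = j then A $$ (i, j) else 0)"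
    by (intro sum.cong) (auto simp: ev_def)
  then show ?thesis
    using assms by (auto simp: mact_def ev_def)
qed

lemma GL_iff_det: "A \<in> carrier (GL m) \<longleftrightarrow> A \<in> carrier_mat m m \<and> det A \<noteq> 0"
  for A :: "'a::field mat"
  unfolding GL_def units_of_carrier
  using unit_imp_det_non_zero[of A m "()"] det_non_zero_imp_unit[of A m "()"]
  by (auto simp: Units_def ring_mat_def)

lemma GL_inverse:
  assumes "A \<in> carrier (GL m)"
  obtains B :: "'a::field mat" where "B \<in> carrier (GL m)" "A * B = 1\<^sub>m m" "B * A = 1\<^sub>m m"
proof -
  interpret group "GL m :: 'a mat monoid" by (rule group_GL)
  from assms show thesis
    using that[of "inv\<^bsub>GL m\<^esub> A"] r_inv[of A] l_inv[of A] inv_closed[of A]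
    by (simp add: mult_GL one_GL)
qed

lemma GL_carrier_mat: "A \<in> carrier (GL m) \<Longrightarrow> A \<in> carrier_mat m m"
  by (simp add: carrier_GL)

lemma GL_mult: "A \<in> carrier (GL m) \<Longrightarrow> B \<in> carrier (GL m) \<Longrightarrow> A * B \<in> carrier (GL m)"
  for A :: "'a::field mat"
  using monoid.m_closed[OF group.is_monoid[OF group_GL]] by (metis mult_GL)

lemma inj_mact:
  assumes "A \<in> carrier (GL m)"
  shows "inj (mact A)"
proof -
  obtain B where B: "B \<in> carrier (GL m)" "B * A = 1\<^sub>m m"
    using GL_inverse[OF assms] by metis
  have "mact B (mact A f) = f" for f
    using mact_mult[of B m A f] B assms by (simp add: GL_carrier_mat mact_one)
  then show ?thesis by (metis injI)
qed

lemma mact_coord_subset: "A \<in> carrier_mat m m \<Longrightarrow> mact A ` coord {..<m} \<subseteq> coord {..<m}"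
  by (auto simp: mact_def coord_def)

lemma mact_coord:
  assumes "A \<in> carrier (GL m)"
  shows "mact A ` coord {..<m} = coord {..<m}"
proof
  show "mact A ` coord {..<m} \<subseteq> coord {..<m}"
    using assms by (simp add: mact_coord_subset GL_carrier_mat)
  obtain B where B: "B \<in> carrier (GL m)" "A * B = 1\<^sub>m m"
    using GL_inverse[OF assms] by metis
  have "mact A (mact B f) = f" for f
    using mact_mult[of A m B f] B assms by (simp add: GL_carrier_mat mact_one)
  then show "coord {..<m} \<subseteq> mact A ` coord {..<m}"
    using mact_coord_subset[OF GL_carrier_mat[OF B(1)]] by (metis image_subset_iff subsetI rev_image_eqI)
qed

text \<open>Writing each unit vector as a combination of the columns gives the columns of a right
  inverse, and a right inverse of a square matrix is two-sided. Injectivity of \<open>v\<close> lets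
  the coefficients be indexed by \<open>j\<close> instead of by vectors.\<close>

lemma columns_GL:
  assumes inj: "inj_on v {..<m}" and span: "coord {..<m} \<subseteq> fn.span (v ` {..<m})"
  shows "mat m m (\<lambda>(i, j). v j i) \<in> carrier (GL m :: 'a::field mat monoid)"
proof -
  let ?A = "mat m m (\<lambda>(i, j). v j i)"
  have "\<exists>c. ev k = (\<Sum>j<m. fscale (c j) (v j))" if "k < m" for k
  proof -
    have "ev k \<in> fn.span (v ` {..<m})"
      using that span ev_in_coord[of k "{..<m}"] by auto
    then obtain u where "ev k = (\<Sum>x\<in>v ` {..<m}. fscale (u x) x)"
      by (auto simp: fn.span_finite)
    then show ?thesis
      by (intro exI[of _ "u \<circ> v"]) (simp add: sum.reindex[OF inj])
  qed
  then obtain c where c: "ev k = (\<Sum>j<m. fscale (c k j) (v j))" if "k < m" for k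
    by metis
  let ?C = "mat m m (\<lambda>(j, k). c k j)"
  have AC: "?A * ?C = 1\<^sub>m m"
  proof (rule eq_matI)
    fix i k assume "i < dim_row (1\<^sub>m m :: 'a mat)" "k < dim_col (1\<^sub>m m :: 'a mat)"
    then have ik: "i < m" "k < m" by auto
    have "(?A * ?C) $$ (i, k) = (\<Sum>j<m. c k j * v j i)"
      using ik by (auto simp: scalar_prod_def lessThan_atLeast0 mult.commute intro!: sum.cong)
    also have "\<dots> = ev k i"
      by (subst c[OF ik(2)]) (simp add: sum_apply)
    finally show "(?A * ?C) $$ (i, k) = 1\<^sub>m m $$ (i, k)"
      using ik by (simp add: ev_def)
  qed auto
  then have "?C * ?A = 1\<^sub>m m"
    by (rule mat_mult_left_right_inverse[rotated 2]) auto
  with AC show ?thesis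
    by (auto simp: carrier_GL invertible_mat_def inverts_mat_def intro!: exI[of _ ?C])
qed

section \<open>The Shalika group as a centralizer, the parabolic as a stabilizer\<close>

lemma det_upper_block:
  fixes A :: "'a::field mat"
  assumes "A \<in> carrier_mat k k" "B \<in> carrier_mat k l" "D \<in> carrier_mat l l"
  shows "det (four_block_mat A B (0\<^sub>m l k) D) = det A * det D"
  using assms by (intro det_four_block_mat_lower_left_zero) auto

lemma upper_block_GL_iff:
  fixes A :: "'a::field mat"
  assumes "A \<in> carrier_mat k k" "B \<in> carrier_mat k l" "D \<in> carrier_mat l l"
  shows "four_block_mat A B (0\<^sub>m l k) D \<in> carrier (GL (k + l)) \<longleftrightarrow>
    A \<in> carrier (GL k) \<and> D \<in> carrier (GL l)"
  using assms by (auto simp: GL_iff_det det_upper_block)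

lemma split_upper_block:
  fixes s :: "'a::field mat"
  assumes "s \<in> carrier_mat (k + l) (k + l)" "\<And>i j. i < l \<Longrightarrow> j < k \<Longrightarrow> s $$ (k + i, j) = 0"
  shows "s = four_block_mat (mat k k (\<lambda>(i, j). s $$ (i, j))) (mat k l (\<lambda>(i, j). s $$ (i, k + j)))
    (0\<^sub>m l k) (mat l l (\<lambda>(i, j). s $$ (k + i, k + j)))"
proof (rule eq_matI, goal_cases)
  case (1 i j)
  then show ?case
    using assms(1) assms(2)[of "i - k" j] by auto
qed (use assms(1) in auto)

lemma sum_lessThan_add: "(\<Sum>j<k + l. h j) = (\<Sum>j<k. h j) + (\<Sum>j<l. h (k + j))"
  for h :: "nat \<Rightarrow> 'a::comm_monoid_add"
  by (induction l) (auto simp: add.assoc)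

text \<open>This is the nilpotent map \<open>N\<close>. The value 0 from index \<open>n\<close> on
  puts its image in \<open>coord {..<n}\<close> and makes its square zero. It reads only the indices
  from \<open>n\<close> to \<open>2 * n - 1\<close>, so it ignores the coordinates that a matrix of
  size \<open>2 * n\<close> leaves fixed.\<close>

definition shift :: "nat \<Rightarrow> (nat \<Rightarrow> 'a::field) \<Rightarrow> nat \<Rightarrow> 'a" where
  "shift n f = (\<lambda>i. if i < n then f (n + i) else 0)"

lemma linear_shift: "Vector_Spaces.linear fscale fscale (shift n)"
  by unfold_locales (auto simp: shift_def fun_eq_iff algebra_simps)

lemma shift_coord: "shift n ` coord J = coord {i. i < n \<and> n + i \<in> J}"
proof (intro equalityI subsetI)
  fix f :: "nat \<Rightarrow> 'a" assume f: "f \<in> coord {i. i < n \<and> n + i \<in> J}"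
  let ?g = "\<lambda>i. if n \<le> i then f (i - n) else 0"
  have "?g \<in> coord J" "shift n ?g = f"
    using f by (auto simp: coord_def shift_def fun_eq_iff)
  then show "f \<in> shift n ` coord J" by (intro image_eqI[OF sym])
qed (auto simp: coord_def shift_def)

lemma mact_shift_upper_block:
  assumes "g \<in> carrier_mat n n" "x \<in> carrier_mat n n"
  shows "mact (four_block_mat g x (0\<^sub>m n n) g) (shift n f) =
    shift n (mact (four_block_mat g x (0\<^sub>m n n) g) f)"
proof
  fix i
  show "mact (four_block_mat g x (0\<^sub>m n n) g) (shift n f) i =
    shift n (mact (four_block_mat g x (0\<^sub>m n n) g) f) i"
    using assms by (auto simp: mact_def shift_def sum_lessThan_add)
qed

lemma shift_ev: "j < n \<Longrightarrow> shift n (ev j) = 0" "j < n \<Longrightarrow> shift n (ev (n + j)) = ev j"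
  by (auto simp: shift_def ev_def fun_eq_iff)

text \<open>For the converse, commutation is tested on unit vectors: \<open>N\<close> kills
  \<open>ev j\<close>, which forces the lower left block to vanish, and it sends
  \<open>ev (n + j)\<close> to \<open>ev j\<close>, which forces the two diagonal blocks to
  agree.\<close>

lemma shalika_iff_commute:
  "s \<in> shalika n \<longleftrightarrow> s \<in> carrier (GL (2 * n)) \<and> (\<forall>f. mact s (shift n f) = shift n (mact s f))"
  for s :: "'a::field mat"
proof safe
  assume "s \<in> shalika n"
  then obtain g x where s: "s = four_block_mat g x (0\<^sub>m n n) g"
    and gx: "g \<in> carrier (GL n)" "x \<in> carrier_mat n n"
    by (auto simp: shalika_def)
  note g = GL_carrier_mat[OF gx(1)]
  show "s \<in> carrier (GL (2 * n))"
    using upper_block_GL_iff[OF g gx(2) g] gx s by (simp add: mult_2)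
  show "mact s (shift n f) = shift n (mact s f)" for f
    using mact_shift_upper_block[OF g gx(2)] s by simp
next
  assume sG: "s \<in> carrier (GL (2 * n))" and c: "\<forall>f. mact s (shift n f) = shift n (mact s f)"
  have s: "s \<in> carrier_mat (2 * n) (2 * n)"
    using sG by (rule GL_carrier_mat)
  interpret M: Vector_Spaces.linear fscale fscale "mact s" by (rule linear_mact)
  have 0: "s $$ (n + i, j) = 0" if "i < n" "j < n" for i j
  proof -
    have "shift n (mact s (ev j)) i = mact s (shift n (ev j)) i"
      using c by simp
    also have "\<dots> = 0"
      using that by (simp add: shift_ev M.zero)
    finally show ?thesis
      using that s by (simp add: shift_def mact_ev[OF s])
  qed
  have 1: "s $$ (n + i, n + j) = s $$ (i, j)" if "i < n" "j < n" for i j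
  proof -
    have "shift n (mact s (ev (n + j))) i = mact s (shift n (ev (n + j))) i"
      using c by simp
    also have "\<dots> = mact s (ev j) i"
      using that by (simp add: shift_ev)
    finally show ?thesis
      using that by (simp add: shift_def mact_ev[OF s])
  qed
  let ?g = "mat n n (\<lambda>(i, j). s $$ (i, j))" and ?x = "mat n n (\<lambda>(i, j). s $$ (i, n + j))"
  have "mat n n (\<lambda>(i, j). s $$ (n + i, n + j)) = ?g"
    by (rule eq_matI) (auto simp: 1)
  then have e: "s = four_block_mat ?g ?x (0\<^sub>m n n) ?g"
    using split_upper_block[of s n n] s 0 by (simp add: mult_2)
  moreover have "?g \<in> carrier (GL n)"
    using sG upper_block_GL_iff[of ?g n ?x n ?g] e by (simp add: mult_2)
  ultimately show "s \<in> shalika n"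
    unfolding shalika_def by (intro CollectI exI[of _ ?g] exI[of _ ?x]) auto
qed

text \<open>On \<open>coord {..<r}\<close> a block triangular matrix acts through its upper left
  block, which is invertible. Conversely, the images of the first \<open>r\<close> unit vectors are
  the first \<open>r\<close> columns, so stability makes their lower parts vanish.\<close>

lemma parabolic_iff_stabilizer:
  "p \<in> parabolic r l \<longleftrightarrow>
    p \<in> carrier (GL (r + l)) \<and> mact p ` coord {..<r} = coord {..<r}"
  for p :: "'a::field mat"
proof safe
  assume "p \<in> parabolic r l"
  then obtain g h x where p: "p = four_block_mat g x (0\<^sub>m l r) h"
    and gh: "g \<in> carrier (GL r)" "h \<in> carrier (GL l)" "x \<in> carrier_mat r l"
    by (auto simp: parabolic_def)
  note g = GL_carrier_mat[OF gh(1)] and h = GL_carrier_mat[OF gh(2)]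
  show "p \<in> carrier (GL (r + l))"
    using upper_block_GL_iff[OF g gh(3) h] gh p by simp
  have "mact p f i = mact g f i" if "f \<in> coord {..<r}" for f i
    using that g h gh(3) p by (auto simp: mact_def sum_lessThan_add coord_def)
  then have "mact p ` coord {..<r} = mact g ` coord {..<r}"
    by (intro image_cong) auto
  then have "mact p ` coord {..<r} = coord {..<r}"
    using mact_coord[OF gh(1)] by simp
  then show "f \<in> coord {..<r} \<Longrightarrow> mact p f \<in> coord {..<r}"
    "f \<in> coord {..<r} \<Longrightarrow> f \<in> mact p ` coord {..<r}" for f
    by auto
next
  assume pG: "p \<in> carrier (GL (r + l))" and st: "mact p ` coord {..<r} = coord {..<r}"
  have p: "p \<in> carrier_mat (r + l) (r + l)"
    using pG by (rule GL_carrier_mat)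
  have 0: "p $$ (r + i, j) = 0" if "i < l" "j < r" for i j
  proof -
    have "mact p (ev j) \<in> coord {..<r}"
      using st ev_in_coord[of j "{..<r}"] that by blast
    then show ?thesis
      using that mact_ev[OF p, of j "r + i"] by (simp add: coord_def)
  qed
  define g x h where "g = mat r r (\<lambda>(i, j). p $$ (i, j))"
    and "x = mat r l (\<lambda>(i, j). p $$ (i, r + j))" and "h = mat l l (\<lambda>(i, j). p $$ (r + i, r + j))"
  have e: "p = four_block_mat g x (0\<^sub>m l r) h"
    using split_upper_block[OF p 0] by (simp add: g_def x_def h_def)
  moreover have "g \<in> carrier (GL r) \<and> h \<in> carrier (GL l)"
  proof (subst upper_block_GL_iff[symmetric])
    show "four_block_mat g x (0\<^sub>m l r) h \<in> carrier (GL (r + l))"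
      using pG e by metis
  qed (auto simp: g_def x_def h_def)
  moreover have "x \<in> carrier_mat r l"
    by (simp add: x_def)
  ultimately show "p \<in> parabolic r l"
    unfolding parabolic_def by blast
qed

section \<open>Double cosets as orbits of subspaces\<close>

lemma mact_mult_GL:
  "A \<in> carrier (GL m) \<Longrightarrow> B \<in> carrier (GL m) \<Longrightarrow> mact (A * B) ` W = mact A ` mact B ` W"
  using mact_mult[of A m B] by (simp add: GL_carrier_mat image_image)

text \<open>Since the parabolic is a stabilizer, \<open>x\<close> lies in \<open>s * g * P\<close>
  exactly when \<open>x\<close> and \<open>s * g\<close> move \<open>coord {..<r}\<close> to the
  same subspace.\<close>

lemma double_coset_shalika_parabolic:
  fixes g :: "'a::field mat"
  assumes n: "r + l = 2 * n" and g: "g \<in> carrier (GL (2 * n))"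
  shows "(shalika n #>\<^bsub>GL (2 * n)\<^esub> g) <#>\<^bsub>GL (2 * n)\<^esub> parabolic r l =
    {x \<in> carrier (GL (2 * n)). \<exists>s\<in>shalika n. mact x ` coord {..<r} = mact s ` mact g ` coord {..<r}}"
proof -
  have eq: "(shalika n #>\<^bsub>GL (2 * n)\<^esub> g) <#>\<^bsub>GL (2 * n)\<^esub> parabolic r l =
      {s * g * p | s p. s \<in> shalika n \<and> p \<in> parabolic r l}"
    by (auto simp: set_mult_def r_coset_def mult_GL)
  show ?thesis unfolding eq
  proof safe
    fix s p :: "'a mat" assume s: "s \<in> shalika n" and p: "p \<in> parabolic r l"
    have sG: "s \<in> carrier (GL (2 * n))" and pG: "p \<in> carrier (GL (2 * n))"
      using s p n by (auto simp: shalika_iff_commute parabolic_iff_stabilizer)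
    show "s * g * p \<in> carrier (GL (2 * n))"
      using sG pG g by (intro GL_mult)
    show "\<exists>t\<in>shalika n. mact (s * g * p) ` coord {..<r} = mact t ` mact g ` coord {..<r}"
      using s p sG pG g 
      by (intro bexI[of _ s])
        (simp_all add: mact_mult_GL[where m = "2 * n"] GL_mult parabolic_iff_stabilizer)
  next
    fix x s :: "'a mat" assume x: "x \<in> carrier (GL (2 * n))" and s: "s \<in> shalika n"
      and e: "mact x ` coord {..<r} = mact s ` mact g ` coord {..<r}"
    have sG: "s \<in> carrier (GL (2 * n))" using s by (simp add: shalika_iff_commute)
    then have sg: "s * g \<in> carrier (GL (2 * n))" using g by (rule GL_mult)
    \<comment> \<open>With \<open>h\<close> inverse to \<open>s * g\<close>, the parabolic factor of
      \<open>x\<close> has to be \<open>h * x\<close>.\<close>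
    obtain h where h: "h \<in> carrier (GL (2 * n))" "s * g * h = 1\<^sub>m (2 * n)" "h * (s * g) = 1\<^sub>m (2 * n)"
      using GL_inverse[OF sg] .
    note c = GL_carrier_mat[OF x] GL_carrier_mat[OF h(1)] GL_carrier_mat[OF sg]
    have "mact (h * x) ` coord {..<r} = mact h ` mact (s * g) ` coord {..<r}"
      using e h x sG g by (simp add: mact_mult_GL[where m = "2 * n"])
    also have "\<dots> = mact (h * (s * g)) ` coord {..<r}"
      by (rule mact_mult_GL[OF h(1) sg, symmetric])
    also have "\<dots> = coord {..<r}"
      using h by (simp add: mact_one)
    finally have "h * x \<in> parabolic r l"
      using n h x by (simp add: parabolic_iff_stabilizer GL_mult)
    moreover have "s * g * (h * x) = x"
      using assoc_mult_mat[OF c(3,2,1)] h(2) c(1) by simp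
    ultimately show "\<exists>t p. x = t * g * p \<and> t \<in> shalika n \<and> p \<in> parabolic r l"
      using s by metis
  qed
qed

section \<open>Coordinate representatives and the normal form\<close>

lemma mact_coord_span:
  assumes "finite J"
  shows "mact A ` coord J = fn.span (mact A ` ev ` J)"
proof -
  interpret M: Vector_Spaces.linear fscale fscale "mact A" by (rule linear_mact)
  show ?thesis
    using M.span_image[of "ev ` J"] by (simp add: span_ev[OF assms])
qed

text \<open>The witness is the matrix of a permutation of the indices that carries
  \<open>{..<r}\<close> onto \<open>J\<close>.\<close>

lemma exists_GL_coord:
  assumes J: "J \<subseteq> {..<m}" "card J = r"
  obtains w :: "'a::field mat" where "w \<in> carrier (GL m)" "mact w ` coord {..<r} = coord J"
proof -
  have "r \<le> m"
    using card_mono[OF _ J(1)] J(2) by simp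
  then obtain p where p: "bij_betw p {..<m} {..<m}" "p ` {..<r} = J"
    using bij_betw_matching_subsets[of "{..<m}" "{..<r}" "{}" "{..<m}" J "{}"] J by auto
  let ?v = "\<lambda>j. ev (p j) :: nat \<Rightarrow> 'a"
  let ?w = "mat m m (\<lambda>(i, j). ?v j i)"
  have im: "?v ` K = ev ` p ` K" for K
    by auto
  have "p ` {..<m} = {..<m}"
    using p(1) by (simp add: bij_betw_def)
  then have "fn.span (?v ` {..<m}) = coord {..<m}"
    unfolding im by (simp add: span_ev)
  moreover have "inj_on ?v {..<m}"
    using p(1) inj_ev by (auto simp: bij_betw_def inj_on_def)
  ultimately have w: "?w \<in> carrier (GL m)"
    by (intro columns_GL) auto
  have "mact ?w (ev j) = ev (p j)" if "j < r" for j
  proof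
    fix i
    have "p j < m"
      using p(2) J that by auto
    then show "mact ?w (ev j) i = ev (p j) i"
      using that \<open>r \<le> m\<close> by (subst mact_ev[of _ m]) (auto simp: ev_def)
  qed
  then have "mact ?w ` ev ` {..<r} = ev ` J"
    unfolding p(2)[symmetric] image_image by (intro image_cong) auto
  then have "mact ?w ` coord {..<r} = coord J"
    using J finite_subset[OF J(1)] by (simp add: mact_coord_span span_ev)
  with w show thesis by (rule that)
qed

text \<open>The coordinates of the representative with \<open>A\<close> and \<open>B\<close> spanned by the unit vectors indexed by
  \<open>{..<a}\<close> and \<open>{a - c..<a - c + b}\<close>, which overlap in \<open>c\<close> indices.\<close>

definition support :: "nat \<Rightarrow> nat \<Rightarrow> nat \<Rightarrow> nat \<Rightarrow> nat set" where
  "support n a b c = {..<a} \<union> (+) n ` {a - c..<a - c + b}"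

text \<open>The numbers \<open>a\<close>, \<open>b\<close>, \<open>c\<close> are the dimensions of
  \<open>A\<close>, \<open>B\<close> and their intersection. The bound
  \<open>a + b \<le> n + c\<close> says that the sum of \<open>A\<close> and \<open>B\<close> has
  dimension at most \<open>n\<close>.\<close>

lemma shalika_normal_form:
  fixes W :: "(nat \<Rightarrow> 'a::field) set"
  assumes W: "fn.subspace W" "W \<subseteq> coord {..<2 * n}"
  obtains s a b c where "s \<in> shalika n" "c \<le> a" "c \<le> b" "a + b \<le> n + c"
    "mact s ` coord (support n a b c) = W"
proof -
  interpret N: Vector_Spaces.linear fscale fscale "shift n :: (nat \<Rightarrow> 'a) \<Rightarrow> _"
    by (rule linear_shift)
  let ?V = "coord {..<n} :: (nat \<Rightarrow> 'a) set"
  let ?A = "W \<inter> ?V" and ?B = "shift n ` W"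
  have A: "fn.subspace ?A"
    by (intro fn.subspace_inter W subspace_coord)
  have B: "fn.subspace ?B" "?B \<subseteq> ?V"
    using W by (auto simp: N.subspace_image) (auto simp: coord_def shift_def)
  obtain D A0 B0 where D: "fn.independent D" "D \<subseteq> ?V" "?V \<subseteq> fn.span D"
    and A0: "A0 \<subseteq> D" "fn.span A0 = ?A" and B0: "B0 \<subseteq> D" "fn.span B0 = ?B"
    using fn.adapted_basis[OF A _ B] by blast
  have finD: "finite D"
    using fn.independent_span_bound[of "ev ` {..<n}" D] D by (simp add: span_ev)
  have cardD: "card D = n"
    using fn.basis_card_eq_dim[OF D(2,3,1)] by (simp add: dim_coord)
  define a b c where "a = card A0" and "b = card B0" and "c = card (A0 \<inter> B0)"
  have fin: "finite A0" "finite B0"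
    using finD A0 B0 finite_subset by auto
  have ca: "c \<le> a" and cb: "c \<le> b"
    unfolding a_def b_def c_def using fin by (auto intro: card_mono)
  have "a + b = card (A0 \<union> B0) + c"
    unfolding a_def b_def c_def using fin by (rule card_Un_Int)
  moreover have "card (A0 \<union> B0) \<le> n"
    unfolding cardD[symmetric] using A0 B0 finD by (intro card_mono) auto
  ultimately have abn: "a + b \<le> n + c" by simp
  let ?I = "{a - c..<a - c + b}"
  have In: "?I \<subseteq> {..<n}" and an: "a \<le> n"
    using abn ca cb by auto
  have "{..<a} \<inter> ?I = {a - c..<a}"
    using ca cb by auto
  then have "card ({..<a} \<inter> ?I) = c"
    using ca by simp
  then obtain v where v: "bij_betw v {..<n} D" "v ` {..<a} = A0" "v ` ?I = B0"
    using bij_betw_matching_subsets[of "{..<n}" "{..<a}" ?I D A0 B0]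
      In an A0 B0 finD cardD a_def b_def c_def by auto
  have vV: "v j \<in> ?V" if "j < n" for j
    using v(1) D(2) that by (auto simp: bij_betw_def)
  have "\<exists>f \<in> coord {..<2 * n}. shift n f = v j \<and> (j \<in> ?I \<longrightarrow> f \<in> W)" if "j < n" for j
  proof (cases "j \<in> ?I")
    case True
    then have "v j \<in> B0" using v(3) by blast
    then have "v j \<in> ?B" using B0(2) fn.span_base by blast
    then show ?thesis using W(2) by auto
  next
    case False
    have "{i. i < n \<and> n + i \<in> {..<2 * n}} = {..<n}" by auto
    then have "v j \<in> shift n ` coord {..<2 * n}"
      using vV[OF that] by (simp only: shift_coord)
    with False show ?thesis by auto
  qed
  then obtain f where f: "f j \<in> coord {..<2 * n}" "shift n (f j) = v j" "j \<in> ?I \<Longrightarrow> f j \<in> W"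
    if "j < n" for j by metis
  \<comment> \<open>Column \<open>n + j\<close> of \<open>s\<close> is meant to be the lift
    \<open>f j\<close>. Its lower half is \<open>shift n (f j) = v j\<close>, so the lower right
    block is \<open>?g\<close> again and \<open>s\<close> falls into the Shalika group.\<close>
  let ?g = "mat n n (\<lambda>(i, j). v j i)" and ?x = "mat n n (\<lambda>(i, j). f j i)"
  define s where "s = four_block_mat ?g ?x (0\<^sub>m n n) ?g"
  have "?g \<in> carrier (GL n)"
    using v(1) D(3) by (intro columns_GL) (auto simp: bij_betw_def)
  then have sS: "s \<in> shalika n"
    unfolding shalika_def s_def by (intro CollectI exI[of _ ?g] exI[of _ ?x]) auto
  have sc: "s \<in> carrier_mat (2 * n) (2 * n)"
    by (auto simp: s_def)
  have s1: "mact s (ev j) = v j" if "j < n" for j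
  proof
    fix i
    show "mact s (ev j) i = v j i"
      using that vV[OF that] by (subst mact_ev[OF sc]) (auto simp: s_def coord_def)
  qed
  have s2: "mact s (ev (n + j)) = f j" if "j < n" for j
  proof
    fix i
    have "v j (i - n) = f j i" if "n \<le> i" "i < 2 * n"
      using that f(2)[OF \<open>j < n\<close>, symmetric] by (simp add: shift_def)
    then show "mact s (ev (n + j)) i = f j i"
      using that f(1)[OF that] by (subst mact_ev[OF sc]) (auto simp: s_def coord_def)
  qed
  have "mact s ` ev ` support n a b c = v ` {..<a} \<union> f ` ?I"
  proof -
    have "(\<lambda>j. mact s (ev j)) ` {..<a} = v ` {..<a}"
      using s1 an by (intro image_cong) auto
    moreover have "(\<lambda>j. mact s (ev (n + j))) ` ?I = f ` ?I"
      using s2 In by (intro image_cong) auto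
    ultimately show ?thesis
      by (simp only: support_def image_Un image_image)
  qed
  then have "mact s ` coord (support n a b c) = fn.span (A0 \<union> f ` ?I)"
    by (simp add: mact_coord_span support_def v)
  also have "\<dots> = W"
  proof (rule fn.span_subspace[OF _ _ W(1)])
    have fW: "f ` ?I \<subseteq> W"
      using f(3) In by blast
    have A0W: "A0 \<subseteq> W"
      using A0(2) fn.span_superset by blast
    show "A0 \<union> f ` ?I \<subseteq> W"
      using fW A0W by blast
    have "B0 = shift n ` f ` ?I"
      unfolding v(3)[symmetric] image_image using f(2) In by (intro image_cong) auto
    then have BI: "?B = shift n ` fn.span (f ` ?I)"
      using N.span_image[of "f ` ?I"] B0(2) by simp
    \<comment> \<open>Subtracting from \<open>w\<close> a combination \<open>y\<close> of the lifts
      with the same image under \<open>N\<close> leaves an element of \<open>W\<close> that vanishes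
      from \<open>n\<close> on: below \<open>2 * n\<close> by equality of the images, beyond by the
      containment of \<open>W\<close>. It thus lies in \<open>A\<close>, which \<open>A0\<close>
      spans.\<close>
    show "W \<subseteq> fn.span (A0 \<union> f ` ?I)"
    proof
      fix w assume w: "w \<in> W"
      then obtain y where y: "y \<in> fn.span (f ` ?I)" "shift n w = shift n y"
        using BI by blast
      have yW: "y \<in> W"
        using y(1) fn.span_minimal[OF fW W(1)] by blast
      have wy: "w - y \<in> W"
        using fn.subspace_diff[OF W(1) w yW] .
      have "(w - y) i = 0" if "n \<le> i" for i
      proof (cases "i < 2 * n")
        case True
        then have "i - n < n" using that by simp
        then show ?thesis
          using fun_cong[OF y(2), of "i - n"] that by (simp add: shift_def)
      next
        case False
        then show ?thesis
          using wy W(2) by (auto simp: coord_def)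
      qed
      then have "w - y \<in> fn.span A0"
        using wy A0(2) by (auto simp: coord_def)
      moreover have "w = (w - y) + y" by simp
      ultimately show "w \<in> fn.span (A0 \<union> f ` ?I)"
        unfolding fn.span_Un using y(1) by blast
    qed
  qed
  finally show thesis
    using that[OF sS ca cb abn] by blast
qed

section \<open>Invariants separating the representatives\<close>

lemma card_support:
  assumes "c \<le> a" "c \<le> b" "a + b \<le> n + c"
  shows "card (support n a b c) = a + b"
proof -
  have "a \<le> n" using assms by simp
  then have "{..<a} \<inter> (+) n ` {a - c..<a - c + b} = {}" by auto
  then show ?thesis
    by (simp add: support_def card_Un_disjoint card_image)
qed

lemma support_subset:
  assumes "c \<le> a" "c \<le> b" "a + b \<le> n + c"
  shows "support n a b c \<subseteq> {..<2 * n}"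
  using assms by (auto simp: support_def)

text \<open>As \<open>N W\<close> lies in \<open>coord {..<n}\<close>, intersecting it with
  \<open>W\<close> or with \<open>A\<close> gives the same space, so the second equation computes
  the intersection of \<open>A\<close> and \<open>B\<close>.\<close>

lemma shift_coord_support:
  assumes "c \<le> a" "c \<le> b" "a + b \<le> n + c"
  shows "shift n ` coord (support n a b c) = coord {a - c..<a - c + b}"
    and "coord (support n a b c) \<inter> shift n ` coord (support n a b c) = coord {a - c..<a}"
proof -
  have "{i. i < n \<and> n + i \<in> support n a b c} = {a - c..<a - c + b}"
    using assms by (auto simp: support_def)
  then show *: "shift n ` coord (support n a b c) = coord {a - c..<a - c + b}"
    by (simp add: shift_coord)
  have "support n a b c \<inter> {a - c..<a - c + b} = {a - c..<a}"
    using assms by (auto simp: support_def)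
  then show "coord (support n a b c) \<inter> shift n ` coord (support n a b c) = coord {a - c..<a}"
    by (simp add: * coord_Int)
qed

text \<open>Commuting with \<open>N\<close>, the injective map \<open>mact s\<close> carries
  \<open>W\<close>, \<open>N W\<close> and their intersection to the corresponding spaces of the
  other representative. Their dimensions are \<open>a + b\<close>, \<open>b\<close> and
  \<open>c\<close>.\<close>

lemma support_orbit_unique:
  fixes s :: "'a::field mat"
  assumes s: "s \<in> shalika n"
    and 1: "c \<le> a" "c \<le> b" "a + b \<le> n + c"
    and 2: "c' \<le> a'" "c' \<le> b'" "a' + b' \<le> n + c'"
    and e: "mact s ` coord (support n a b c) = coord (support n a' b' c')"
  shows "a = a' \<and> b = b' \<and> c = c'"
proof -
  let ?W = "coord (support n a b c) :: (nat \<Rightarrow> 'a) set"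
  let ?W' = "coord (support n a' b' c') :: (nat \<Rightarrow> 'a) set"
  have inj: "inj (mact s)"
    using s by (intro inj_mact[of s "2 * n"]) (simp add: shalika_iff_commute)
  have dim: "fn.dim (mact s ` X) = fn.dim X" for X
    by (rule fn.dim_linear_image[OF linear_mact inj])
  have fin: "finite (support n a b c)" "finite (support n a' b' c')"
    by (simp_all add: support_def)
  have N: "mact s ` shift n ` ?W = shift n ` ?W'"
    using s by (simp add: e[symmetric] image_image shalika_iff_commute)
  have I: "mact s ` (?W \<inter> shift n ` ?W) = ?W' \<inter> shift n ` ?W'"
    by (simp add: image_Int[OF inj] e N)
  have "a + b = a' + b'"
    using dim[of ?W] unfolding e by (simp add: dim_coord fin card_support[OF 1] card_support[OF 2])
  moreover have "b = b'"
    using dim[of "shift n ` ?W", unfolded N]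
    by (simp add: shift_coord_support[OF 1] shift_coord_support[OF 2] dim_coord)
  moreover have "c = c'"
    using dim[of "?W \<inter> shift n ` ?W", unfolded I] 1 2
    unfolding shift_coord_support(2)[OF 1] shift_coord_support(2)[OF 2]
    by (simp add: dim_coord)
  ultimately show ?thesis
    by simp
qed

section \<open>The parametrization of the double cosets\<close>

lemma shalika_mult:
  assumes "s \<in> shalika n" "t \<in> shalika n"
  shows "s * t \<in> shalika n"
  using assms by (auto simp: shalika_iff_commute GL_mult mact_mult[of _ "2 * n"] GL_carrier_mat)

lemma shalika_inverse:
  fixes s :: "'a::field mat"
  assumes s: "s \<in> shalika n"
  obtains t where "t \<in> shalika n" "\<And>W. mact t ` mact s ` W = W"
proof -
  have sG: "s \<in> carrier (GL (2 * n))" using s by (simp add: shalika_iff_commute)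
  then obtain t where t: "t \<in> carrier (GL (2 * n))" "s * t = 1\<^sub>m (2 * n)" "t * s = 1\<^sub>m (2 * n)"
    by (rule GL_inverse)
  have st: "mact s (mact t f) = f" for f
    using mact_mult[OF GL_carrier_mat[OF sG] GL_carrier_mat[OF t(1)], of f] t(2)
    by (simp add: mact_one)
  have ts: "mact t (mact s f) = f" for f
    using mact_mult[OF GL_carrier_mat[OF t(1)] GL_carrier_mat[OF sG], of f] t(3)
    by (simp add: mact_one)
  have "mact t (shift n f) = shift n (mact t f)" for f
  proof -
    have "mact t (shift n f) = mact t (shift n (mact s (mact t f)))"
      by (simp add: st)
    also have "\<dots> = mact t (mact s (shift n (mact t f)))"
      using s by (simp add: shalika_iff_commute)
    finally show ?thesis by (simp add: ts)
  qed
  then have "t \<in> shalika n"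
    using t(1) by (simp add: shalika_iff_commute)
  then show thesis
    by (rule that) (simp add: image_image ts)
qed

lemma one_shalika: "1\<^sub>m (2 * n) \<in> (shalika n :: 'a::field mat set)"
  by (simp add: shalika_iff_commute GL_iff_det mact_one)

text \<open>An index \<open>(c, a)\<close> stands for the representative with
  \<open>b = r - a\<close>. Truncated subtraction makes the lower bound \<open>r - n\<close> equal
  to max(0, r - n), and \<open>r div 2\<close> is the last \<open>c\<close> for which
  \<open>{c..r - c}\<close> is nonempty.\<close>

lemma bij_betw_double_cosets_shalika_parabolic:
  assumes "r \<le> 2 * n"
  shows "\<exists>\<Phi>. bij_betw \<Phi> (SIGMA c:{r - n..r div 2}. {c..r - c})
    (double_cosets (GL (2 * n) :: 'a::field mat monoid) (shalika n) (parabolic r (2 * n - r)))"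
proof -
  let ?G = "carrier (GL (2 * n) :: 'a mat monoid)"
  let ?I = "SIGMA c:{r - n..r div 2}. {c..r - c}"
  let ?D = "double_cosets (GL (2 * n) :: 'a mat monoid) (shalika n) (parabolic r (2 * n - r))"
  let ?F = "coord {..<r} :: (nat \<Rightarrow> 'a) set"
  let ?supp = "\<lambda>c a. support n a (r - a) c"
  \<comment> \<open>An orbit of subspaces is recorded by the group elements that move
    \<open>coord {..<r}\<close> into it, so that it is itself a double coset.\<close>
  define orbit :: "(nat \<Rightarrow> 'a) set \<Rightarrow> 'a mat set" where
    "orbit W = {x \<in> ?G. \<exists>s\<in>shalika n. mact x ` ?F = mact s ` W}" for W
  have dc: "(shalika n #>\<^bsub>GL (2 * n)\<^esub> g) <#>\<^bsub>GL (2 * n)\<^esub> parabolic r (2 * n - r)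
      = orbit (mact g ` ?F)" if "g \<in> ?G" for g
    unfolding orbit_def using assms that by (intro double_coset_shalika_parabolic) auto
  have D: "?D = (\<lambda>g. orbit (mact g ` ?F)) ` ?G"
    unfolding double_cosets_def using dc by (auto simp: image_iff)
  have sub: "orbit (mact s ` W) \<subseteq> orbit W" if s: "s \<in> shalika n" for s W
    unfolding orbit_def
  proof clarify
    fix x t :: "'a mat" assume x: "mact x ` ?F = mact t ` mact s ` W" and t: "t \<in> shalika n"
    have "mact x ` ?F = mact (t * s) ` W"
      using x s t mact_mult_GL[of t "2 * n" s W] by (simp add: shalika_iff_commute)
    then show "\<exists>u\<in>shalika n. mact x ` ?F = mact u ` W"
      using shalika_mult[OF t s] by blast
  qed
  have orbit_mact: "orbit (mact s ` W) = orbit W" if s: "s \<in> shalika n" for s W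
  proof -
    obtain t where t: "t \<in> shalika n" "mact t ` mact s ` W = W"
      using shalika_inverse[OF s] by metis
    show ?thesis
      using sub[OF s, of W] sub[OF t(1), of "mact s ` W"] t(2) by auto
  qed
  \<comment> \<open>The index conditions are restated as the constraints on \<open>a\<close>,
    \<open>b\<close>, \<open>c\<close> from the normal form, with \<open>a \<le> r\<close> added to
    keep \<open>r - a\<close> an honest difference.\<close>
  have I: "(c, a) \<in> ?I \<longleftrightarrow> a \<le> r \<and> c \<le> a \<and> c \<le> r - a \<and> a + (r - a) \<le> n + c" for c a
    by auto
  have rep: "\<exists>w\<in>?G. mact w ` ?F = coord (?supp c a)" if "(c, a) \<in> ?I" for c a
  proof -
    have "card (?supp c a) = r" "?supp c a \<subseteq> {..<2 * n}"
      using that card_support[of c a "r - a" n] support_subset[of c a "r - a" n] unfolding I by auto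
    then show ?thesis
      using exists_GL_coord[of "?supp c a" "2 * n" r] by metis
  qed
  have "inj_on (\<lambda>(c, a). orbit (coord (?supp c a))) ?I"
  proof (intro inj_onI, clarify, goal_cases)
    case (1 c a c' a')
    then have ca: "(c, a) \<in> ?I" "(c', a') \<in> ?I"
      and e: "orbit (coord (?supp c a)) = orbit (coord (?supp c' a'))" by auto
    obtain w where w: "w \<in> ?G" "mact w ` ?F = coord (?supp c a)"
      using rep[OF ca(1)] by blast
    \<comment> \<open>The identity of the Shalika group puts \<open>w\<close> in the first orbit,
      hence in the second, which relates the two representatives by some \<open>s\<close>.\<close>
    have "mact w ` ?F = mact (1\<^sub>m (2 * n)) ` coord (?supp c a)"
      using w(2) by (simp add: mact_one)
    then have "w \<in> orbit (coord (?supp c a))"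
      unfolding orbit_def using w(1) one_shalika by blast
    then obtain s where s: "s \<in> shalika n" "mact w ` ?F = mact s ` coord (?supp c' a')"
      unfolding e unfolding orbit_def by blast
    show ?case
      using support_orbit_unique[OF s(1) _ _ _ _ _ _ s(2)[symmetric, unfolded w(2)]] ca unfolding I by auto
  qed
  moreover have "(\<lambda>(c, a). orbit (coord (?supp c a))) ` ?I = ?D"
  proof (intro equalityI subsetI)
    fix X assume "X \<in> (\<lambda>(c, a). orbit (coord (?supp c a))) ` ?I"
    then obtain c a where ca: "(c, a) \<in> ?I" "X = orbit (coord (?supp c a))" by auto
    obtain w where "w \<in> ?G" "mact w ` ?F = coord (?supp c a)"
      using rep[OF ca(1)] by blast
    then show "X \<in> ?D"
      unfolding D ca(2) by (intro image_eqI[of _ _ w]) simp_all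
  next
    fix X assume "X \<in> ?D"
    then obtain g where g: "g \<in> ?G" "X = orbit (mact g ` ?F)" unfolding D by blast
    interpret M: Vector_Spaces.linear fscale fscale "mact g" by (rule linear_mact)
    have "mact g ` ?F \<subseteq> mact g ` coord {..<2 * n}"
      using assms by (intro image_mono coord_mono) auto
    then have "mact g ` ?F \<subseteq> coord {..<2 * n}"
      using mact_coord[OF g(1)] by simp
    then obtain s a b c where s: "s \<in> shalika n"
      and abc: "c \<le> a" "c \<le> b" "a + b \<le> n + c"
      and e: "mact s ` coord (support n a b c) = mact g ` ?F"
      using shalika_normal_form[OF M.subspace_image[OF subspace_coord]] by metis
    \<comment> \<open>The normal form does not mention \<open>r\<close>; comparing dimensions gives
      \<open>a + b = r\<close>.\<close>
    have "inj (mact s)"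
      using s by (intro inj_mact[of s "2 * n"]) (simp add: shalika_iff_commute)
    then have "fn.dim (mact s ` coord (support n a b c)) = fn.dim (coord (support n a b c) :: (nat \<Rightarrow> 'a) set)"
      by (rule fn.dim_linear_image[OF linear_mact])
    moreover have "fn.dim (mact g ` ?F) = fn.dim ?F"
      using fn.dim_linear_image[OF linear_mact inj_mact[OF g(1)]] .
    ultimately have "a + b = r"
      using e by (simp add: dim_coord card_support[OF abc] support_def[of n a b c, THEN arg_cong[of _ _ finite]])
    then have "(c, a) \<in> ?I" "b = r - a"
      unfolding I using abc by auto
    moreover have "X = orbit (coord (support n a b c))"
      using g(2) orbit_mact[OF s] e by metis
    ultimately show "X \<in> (\<lambda>(c, a). orbit (coord (?supp c a))) ` ?I"
      by force
  qed
  ultimately show ?thesis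
    unfolding bij_betw_def by blast
qed

section \<open>The count\<close>

text \<open>An arithmetic progression: the number of terms times the mean of the first and the
  last.\<close>

lemma sum_linear_interval:
  fixes x y :: nat
  assumes "x \<le> y"
  shows "(\<Sum>c = x..y. k - 2 * real c) = (real y - real x + 1) * (k - real x - real y)"
  using assms by (induction y rule: dec_induct) (auto simp: algebra_simps)

theorem theorem1p2:
  fixes n r :: nat and \<alpha> \<beta> \<gamma> :: int
  assumes "1 \<le> r" and "r < 2 * n"
    and "\<alpha> = max 0 (int r - int n)"
    and "\<gamma> = min (int r) (int n)"
    and "\<beta> = \<lfloor>real r / 2\<rfloor>"
  shows "let D = double_cosets (GL (2 * n) :: 'a::field mat monoid)
                   (shalika n) (parabolic r (2 * n - r))
         in finite D \<and>
            real (card D) =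
              real_of_int ((\<beta> - \<alpha> + 1) * (\<beta> - \<alpha> + 2) + (\<gamma> - \<beta>) * (\<gamma> - \<beta> + 1)) / 2"
proof -
  let ?D = "double_cosets (GL (2 * n) :: 'a mat monoid) (shalika n) (parabolic r (2 * n - r))"
  let ?I = "SIGMA c:{r - n..r div 2}. {c..r - c}"
  obtain \<Phi> where "bij_betw \<Phi> ?I ?D"
    using bij_betw_double_cosets_shalika_parabolic[of r n] assms(2) by auto
  then have fin: "finite ?D" and card: "card ?D = card ?I"
    using bij_betw_finite bij_betw_same_card by fastforce+
  have "real (card ?I) = (\<Sum>c = r - n..r div 2. real (Suc (r - c) - c))"
    by simp
  also have "\<dots> = (\<Sum>c = r - n..r div 2. (real r + 1) - 2 * real c)"
    by (intro sum.cong) (auto simp: of_nat_diff)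
  also have "\<dots> = (real (r div 2) - real (r - n) + 1) * (real r + 1 - real (r - n) - real (r div 2))"
    using assms(2) by (intro sum_linear_interval) auto
  finally have N: "real (card ?D) =
    (real (r div 2) - real (r - n) + 1) * (real r + 1 - real (r - n) - real (r div 2))"
    using card by simp
  \<comment> \<open>The identity min(r, n) = r - max(0, r - n) expresses \<open>\<gamma>\<close>
    through \<open>\<alpha>\<close>.\<close>
  have \<alpha>: "\<alpha> = int (r - n)" and \<gamma>: "\<gamma> = int r - int (r - n)"
    using assms(3,4) by auto
  have \<beta>: "\<beta> = int (r div 2)"
    using assms(5) floor_divide_of_nat_eq[of r 2, where ?'a = real] by simp
  \<comment> \<open>The count is \<open>(p + 1) * (q + 1)\<close>. Since \<open>q - p\<close> equals
    r - 2 \<open>\<beta>\<close>, it is 0 or 1 by the parity of \<open>r\<close>, and in both cases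
    this product agrees with the symmetric-looking half sum.\<close>
  define p q where "p = real_of_int (\<beta> - \<alpha>)" and "q = real_of_int (\<gamma> - \<beta>)"
  have "int r - 2 * int (r div 2) = 0 \<or> int r - 2 * int (r div 2) = 1"
    by presburger
  then have "\<gamma> - \<beta> = \<beta> - \<alpha> \<or> \<gamma> - \<beta> = \<beta> - \<alpha> + 1"
    unfolding \<alpha> \<beta> \<gamma> by linarith
  then have "q = p \<or> q = p + 1"
    unfolding p_def q_def by linarith
  then have "(p + 1) * (q + 1) = ((p + 1) * (p + 2) + q * (q + 1)) / 2"
    by (auto simp: field_simps)
  moreover have "real (card ?D) = (p + 1) * (q + 1)"
    unfolding N p_def q_def \<alpha> \<beta> \<gamma> by (simp add: algebra_simps)
  ultimately show ?thesis
    using fin by (simp add: p_def q_def)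
qed

end
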